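(* Let $(H_1,(\cdot,\cdot))$, $(H_2,((\cdot,\cdot)))$ and $(H_3,\langle\cdot,\cdot\rangle)$ be real Hilbert spaces, let $K_1\subset H_1$ and $K_2\subset H_2$ be closed convex sets, and let $a:H_1\to H_3$ and $b:H_2\to H_3$ be maps such that for every $y\in K_2$ the function $x\mapsto\langle a(x),b(y)\rangle$ is convex, and such that $\tilde K_2:=b(K_2)$ is closed and convex. Let $f:H_1\to H_1$. Assume that: (i) $f$ is $\alpha$ monotone; (ii) $a$ is $C$-Lipschitz for some constant $C>0$ and differentiable; (iii) there exists a couple $(x_*,y_* )\in K_1\times K_2$ satisfying $$\begin{cases}(f(x_* ),x'-x_* )+\langle a(x')-a(x_* ),b(y_* )\rangle\ge 0,& \forall x'\in K_1;\\ \langle a(x_* ),b(y')-b(y_* )\rangle\le 0,&\forall y'\in K_2.\end{cases}$$ Then for any $y_0\in K_2$, if $0<\delta<\frac{2\alpha}{C^2}$, the following iteration indeed defines a sequence $(x_n,y_n)_{n\in\mathbb N}$: for all $n\ge 0$, $x_n$ is the element of $K_1$ defined by $$(f(x_n),x'-x_n)+\langle a(x')-a(x_n),b(y_n)\rangle\ge 0\quad\forall x'\in K_1,$$ and $y_{n+1}$ is (any) element of $b^{-1}\big(\{\mathbf P_{\tilde K_2}(b(y_n)+\delta a(x_n))\}\big)$. Moreover $(x_n)_{n\in\mathbb N}$ converges to $x_*$ in $H_1$.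
   Context: A map $f$ from a Hilbert space $(H,\langle\cdot,\cdot\rangle)$ to itself is called $\alpha$ monotone if $\langle f(x)-f(y),x-y\rangle\ge\alpha\langle x-y,x-y\rangle$ for all $x,y\in H$. Here $\delta>0$ is a fixed real number (so the condition $\delta<2\alpha/C^2$ forces $\alpha>0$). $\mathbf P_A$ denotes the orthogonal projection in $H_3$ onto the closed convex set $A$.
   Formalization: Existence of x_n, and so of an infinite sequence, is claimed only for f hemicontinuous (weakly continuous along segments); without this it can fail, e.g. on the real line when f jumps over 0. Uniqueness of x_n, existence of y_{n+1} and convergence need no such assumption. *)

theory Defs
  imports "HOL-Analysis.Analysis"
begin

text \<open>Real Hilbert spaces are types of sort \<open>{real_inner, banach}\<close>.\<close>

definition strongly_monotone :: "real \<Rightarrow> ('a::real_inner \<Rightarrow> 'a) \<Rightarrow> bool" where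
  "strongly_monotone \<alpha> f \<longleftrightarrow>
     (\<forall>x y. (f x - f y) \<bullet> (x - y) \<ge> \<alpha> * ((x - y) \<bullet> (x - y)))"

text \<open>Continuity along segments with respect to the weak topology of the target, as in the
  Minty-Browder theory of monotone operators; implied by continuity. Unrelated to the
  hemicontinuity of set-valued maps in the library.\<close>

definition hemicontinuous :: "('a::real_inner \<Rightarrow> 'a) \<Rightarrow> bool" where
  "hemicontinuous f \<longleftrightarrow>
     (\<forall>x y z. continuous_on {0..1::real} (\<lambda>t. f (x + t *\<^sub>R (y - x)) \<bullet> z))"

text \<open>The library's \<^const>\<open>closest_point\<close> is only available for spaces with the Heine-Borel
  property, which excludes infinite-dimensional Hilbert spaces.\<close>

definition proj :: "'a::real_inner set \<Rightarrow> 'a \<Rightarrow> 'a" where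
  "proj A u = (THE p. p \<in> A \<and> (\<forall>q\<in>A. dist u p \<le> dist u q))"

definition primal_vi ::
  "('h1::real_inner) set \<Rightarrow> ('h1 \<Rightarrow> 'h1) \<Rightarrow> ('h1 \<Rightarrow> 'h3::real_inner) \<Rightarrow> ('h2 \<Rightarrow> 'h3)
    \<Rightarrow> 'h2 \<Rightarrow> 'h1 \<Rightarrow> bool" where
  "primal_vi K1 f a b y x \<longleftrightarrow>
     x \<in> K1 \<and> (\<forall>x'\<in>K1. f x \<bullet> (x' - x) + (a x' - a x) \<bullet> b y \<ge> 0)"

definition dual_vi ::
  "('h2::real_inner) set \<Rightarrow> ('h1 \<Rightarrow> 'h3::real_inner) \<Rightarrow> ('h2 \<Rightarrow> 'h3) \<Rightarrow> 'h1 \<Rightarrow> 'h2 \<Rightarrow> bool" where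
  "dual_vi K2 a b x y \<longleftrightarrow> y \<in> K2 \<and> (\<forall>y'\<in>K2. a x \<bullet> (b y' - b y) \<le> 0)"

text \<open>The admissible successors of \<open>y\<close>. The preimage is taken under \<open>b\<close> as a map on the whole
  space, so a successor need not lie in \<open>K2\<close>, although its image under \<open>b\<close> lies in \<open>b ` K2\<close>.\<close>

definition dual_updates ::
  "('h2::real_inner) set \<Rightarrow> ('h1 \<Rightarrow> 'h3::real_inner) \<Rightarrow> ('h2 \<Rightarrow> 'h3) \<Rightarrow> real
    \<Rightarrow> 'h1 \<Rightarrow> 'h2 \<Rightarrow> 'h2 set" where
  "dual_updates K2 a b \<delta> x y = b -` {proj (b ` K2) (b y + \<delta> *\<^sub>R a x)}"

text \<open>\<open>iterates_upto K1 K2 f a b \<delta> y0 N x y\<close>: the terms \<open>y 0, x 0, \<dots>, y (N - 1), x (N - 1), y N\<close>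
  have been generated by the algorithm; later terms are arbitrary.\<close>

definition iterates_upto ::
  "('h1::real_inner) set \<Rightarrow> ('h2::real_inner) set \<Rightarrow> ('h1 \<Rightarrow> 'h1)
    \<Rightarrow> ('h1 \<Rightarrow> 'h3::real_inner) \<Rightarrow> ('h2 \<Rightarrow> 'h3) \<Rightarrow> real \<Rightarrow> 'h2
    \<Rightarrow> nat \<Rightarrow> (nat \<Rightarrow> 'h1) \<Rightarrow> (nat \<Rightarrow> 'h2) \<Rightarrow> bool" where
  "iterates_upto K1 K2 f a b \<delta> y0 N x y \<longleftrightarrow>
     y 0 = y0 \<and>
     (\<forall>n<N. primal_vi K1 f a b (y n) (x n) \<and> y (Suc n) \<in> dual_updates K2 a b \<delta> (x n) (y n))"

definition iterates ::
  "('h1::real_inner) set \<Rightarrow> ('h2::real_inner) set \<Rightarrow> ('h1 \<Rightarrow> 'h1)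
    \<Rightarrow> ('h1 \<Rightarrow> 'h3::real_inner) \<Rightarrow> ('h2 \<Rightarrow> 'h3) \<Rightarrow> real \<Rightarrow> 'h2
    \<Rightarrow> (nat \<Rightarrow> 'h1) \<Rightarrow> (nat \<Rightarrow> 'h2) \<Rightarrow> bool" where
  "iterates K1 K2 f a b \<delta> y0 x y \<longleftrightarrow>
     y 0 = y0 \<and>
     (\<forall>n. primal_vi K1 f a b (y n) (x n) \<and> y (Suc n) \<in> dual_updates K2 a b \<delta> (x n) (y n))"

end

theory Submission
  imports Defs
begin

text \<open>The algorithm is a projected gradient ascent for the dual variable \<open>b y\<close>. Adding the primal
  inequalities at \<open>(x n, y n)\<close> and at \<open>(xs, ys)\<close> gives
  \<open>(a (x n) - a xs) \<bullet> (b (y n) - b ys) \<le> - \<alpha> * (norm (x n - xs))\<^sup>2\<close>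
  (\<open>primal_vi_cross_estimate\<close>, which for equal dual variables also yields uniqueness). Since \<open>b ys\<close> is
  the projection of \<open>b ys + \<delta> *\<^sub>R a xs\<close> and projections are nonexpansive, the squared distance of
  \<open>b (y n)\<close> to \<open>b ys\<close> drops in each step by at least
  \<open>\<delta> * (2 * \<alpha> - \<delta> * C\<^sup>2) * (norm (x n - xs))\<^sup>2\<close> (\<open>dual_step_estimate\<close>). The bound on \<open>\<delta>\<close> makes
  the factor positive, so these terms are summable and \<open>x n\<close> converges to \<open>xs\<close>.

  That the iteration is well defined rests on two existence theorems, both derived from the finite
  intersection property of bounded closed convex sets in a Hilbert space
  (\<open>bounded_closed_convex_fip\<close>). One is the existence of projections. The other is the solvability of
  the primal variational inequality for hemicontinuous \<open>f\<close> (\<open>strongly_monotone_vi_solvable\<close>): by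
  Minty's method a solution is a point satisfying a family of concave inequalities, and any finite
  subfamily is solvable because \<open>f\<close> is monotone (\<open>concave_system_solvable\<close>).\<close>

section \<open>Intersections of bounded closed convex sets in a Hilbert space\<close>

lemma midpoint_parallelogram:
  fixes x y :: "'a::real_inner"
  shows "(norm (x - y))\<^sup>2 = 2 * (norm x)\<^sup>2 + 2 * (norm y)\<^sup>2 - 4 * (norm (midpoint x y))\<^sup>2"
  by (simp add: midpoint_def power2_norm_eq_inner algebra_simps inner_commute)

text \<open>The finite intersection property for closed convex sets one of which is bounded, a form of weak
  compactness of balls. Finite intersections whose distance from the origin is within \<open>\<eta>\<close> of the supremum \<open>D\<close>
  of all such distances have, when cut with a ball of radius \<open>D + \<eta>\<close>, a diameter that tends to \<open>0\<close>
  with \<open>\<eta>\<close>, by the parallelogram law. So the claim reduces to Cantor's intersection theorem for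
  complete metric spaces.\<close>

lemma bounded_closed_convex_fip:
  fixes \<S> :: "'a::{real_inner, banach} set set"
  assumes closed: "\<And>S. S \<in> \<S> \<Longrightarrow> closed S"
    and convex: "\<And>S. S \<in> \<S> \<Longrightarrow> convex S"
    and T: "T \<in> \<S>" "bounded T"
    and fip: "\<And>\<F>. finite \<F> \<Longrightarrow> \<F> \<subseteq> \<S> \<Longrightarrow> \<Inter>\<F> \<noteq> {}"
  shows "\<Inter>\<S> \<noteq> {}"
proof -
  define \<A> where "\<A> = {\<F>. finite \<F> \<and> \<F> \<subseteq> \<S>}"
  define d where "d = (\<lambda>\<F>. infdist (0::'a) (\<Inter>\<F>))"
  define D where "D = (SUP \<F>\<in>\<A>. d \<F>)"
  define \<C> where "\<C> = {\<Inter>\<F> \<inter> cball 0 r |\<F> r. \<F> \<in> \<A> \<and> D < r}"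
  have ne: "\<Inter>\<F> \<noteq> {}" if "\<F> \<in> \<A>" for \<F>
    using fip that by (auto simp: \<A>_def)
  obtain R where R: "\<And>x. x \<in> T \<Longrightarrow> norm x \<le> R"
    using T(2) by (auto simp: bounded_iff)
  have "d \<F> \<le> R" if F: "\<F> \<in> \<A>" for \<F>
  proof -
    have "insert T \<F> \<in> \<A>" using F T by (auto simp: \<A>_def)
    then have "\<Inter>(insert T \<F>) \<noteq> {}" by (rule ne)
    then obtain z where z: "z \<in> T" "z \<in> \<Inter>\<F>" by (simp add: ex_in_conv[symmetric]) blast
    have "d \<F> \<le> dist 0 z" unfolding d_def using z(2) by (rule infdist_le)
    with R[OF z(1)] show ?thesis by simp
  qed
  then have bdd: "bdd_above (d ` \<A>)" by (auto simp: bdd_above_def)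
  then have dD: "d \<F> \<le> D" if "\<F> \<in> \<A>" for \<F>
    unfolding D_def using that by (intro cSUP_upper)
  have empty: "{} \<in> \<A>" by (simp add: \<A>_def)
  have D0: "0 \<le> D" using dD[OF empty] infdist_nonneg order_trans unfolding d_def by blast
  have nonempty: "C \<noteq> {}" if "C \<in> \<C>" for C
  proof -
    obtain \<F> r where C: "C = \<Inter>\<F> \<inter> cball 0 r" "\<F> \<in> \<A>" "D < r"
      using \<open>C \<in> \<C>\<close> unfolding \<C>_def by blast
    have "(INF z\<in>\<Inter>\<F>. dist 0 z) < r"
      using dD[OF C(2)] C(3) ne[OF C(2)] by (simp add: d_def infdist_def)
    moreover have "bdd_below (dist (0::'a) ` \<Inter>\<F>)" by (rule bdd_belowI2[of _ 0]) simp
    ultimately obtain z where "z \<in> \<Inter>\<F>" "dist 0 z < r"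
      using cINF_less_iff[OF ne[OF C(2)], of "dist 0" r] by blast
    then have "z \<in> C" unfolding C(1) by (simp del: Inter_iff)
    then show ?thesis by blast
  qed
  have Int: "C \<inter> C' \<in> \<C>" if CC: "C \<in> \<C>" "C' \<in> \<C>" for C C'
  proof -
    obtain \<F> r where C: "C = \<Inter>\<F> \<inter> cball 0 r" "\<F> \<in> \<A>" "D < r"
      using CC(1) unfolding \<C>_def by blast
    obtain \<F>' r' where C': "C' = \<Inter>\<F>' \<inter> cball 0 r'" "\<F>' \<in> \<A>" "D < r'"
      using CC(2) unfolding \<C>_def by blast
    have "C \<inter> C' = \<Inter>(\<F> \<union> \<F>') \<inter> cball 0 (min r r')"
      unfolding C(1) C'(1) Inter_Un_distrib by (auto simp del: Inter_iff)
    moreover have "\<F> \<union> \<F>' \<in> \<A>" "D < min r r'"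
      using C C' by (auto simp: \<A>_def)
    ultimately show ?thesis unfolding \<C>_def by blast
  qed
  have "\<Inter>\<C> \<noteq> {}"
  proof -
    have "Met_TC.mcomplete TYPE('a)"
      by (simp add: complete_UNIV)
    then have fip: "\<forall>\<C>. (\<forall>C\<in>\<C>. closed C) \<and> (\<forall>e>0. \<exists>C (a::'a). C \<in> \<C> \<and> C \<subseteq> cball a e) \<and>
        (\<forall>\<F>. finite \<F> \<and> \<F> \<subseteq> \<C> \<longrightarrow> \<Inter>\<F> \<noteq> {}) \<longrightarrow> \<Inter>\<C> \<noteq> {}"
      unfolding Met_TC.mcomplete_fip by simp
    have cl: "closed C" if "C \<in> \<C>" for C
      using that closed unfolding \<C>_def \<A>_def by (auto intro!: closed_Int closed_Inter)
    have small: "\<exists>C a. C \<in> \<C> \<and> C \<subseteq> cball a e" if "0 < e" for e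
    proof -
      \<comment> \<open>Chosen so that the bound \<open>16 * \<eta> * (D + 1)\<close> on the squared diameter is at most \<open>e\<^sup>2\<close>.\<close>
      define \<eta> where "\<eta> = min 1 (e\<^sup>2 / (16 * (D + 1)))"
      have \<eta>: "0 < \<eta>" "\<eta> \<le> 1" using \<open>0 < e\<close> D0 by (auto simp: \<eta>_def)
      have "\<eta> \<le> e\<^sup>2 / (16 * (D + 1))" by (simp add: \<eta>_def)
      then have \<eta>e: "\<eta> * (16 * (D + 1)) \<le> e\<^sup>2" using D0 by (subst (asm) pos_le_divide_eq) auto
      have "D - \<eta> < (SUP \<F>\<in>\<A>. d \<F>)" using \<eta> by (simp add: D_def)
      then obtain \<F> where F: "\<F> \<in> \<A>" "D - \<eta> < d \<F>"
        using less_cSUP_iff[OF _ bdd, of "D - \<eta>"] empty by auto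
      define C where "C = \<Inter>\<F> \<inter> cball 0 (D + \<eta>)"
      have CC: "C \<in> \<C>" using F \<eta> unfolding C_def \<C>_def by fastforce
      then obtain p where p: "p \<in> C" using nonempty by blast
      have "dist p q \<le> e" if q: "q \<in> C" for q
      proof -
        define m where "m = norm (midpoint p q)"
        have conv: "convex (\<Inter>\<F>)" "convex C"
          using F convex unfolding C_def \<A>_def by (auto intro!: convex_Inter convex_Int)
        have "midpoint p q \<in> C"
          using conv(2) p q by (metis closed_segment_subset midpoint_in_closed_segment subsetD)
        then have m: "midpoint p q \<in> \<Inter>\<F>" "m \<le> D + \<eta>" by (auto simp: C_def m_def)
        have "d \<F> \<le> m" using infdist_le[OF m(1), of 0] by (simp add: d_def m_def)
        then have m': "D - \<eta> \<le> m" using F by simp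
        have pq: "norm p \<le> D + \<eta>" "norm q \<le> D + \<eta>" using p q by (auto simp: C_def)
        have "(norm (p - q))\<^sup>2 = 2 * (norm p)\<^sup>2 + 2 * (norm q)\<^sup>2 - 4 * m\<^sup>2"
          unfolding m_def by (rule midpoint_parallelogram)
        also have "\<dots> \<le> 2 * (D + \<eta>)\<^sup>2 + 2 * (D + \<eta>)\<^sup>2 - 4 * m\<^sup>2"
          using pq by (intro diff_right_mono add_mono mult_left_mono power_mono) auto
        also have "\<dots> = 4 * ((D + \<eta> - m) * (D + \<eta> + m))"
          by (simp add: power2_eq_square algebra_simps)
        also have "\<dots> \<le> 4 * ((2 * \<eta>) * (2 * (D + 1)))"
          using m m' \<eta> D0 by (intro mult_left_mono mult_mono) (auto simp: m_def)
        also have "\<dots> \<le> e\<^sup>2" using \<eta>e by (simp add: algebra_simps)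
        finally have "norm (p - q) \<le> e" using \<open>0 < e\<close> by (simp add: power2_le_iff_abs_le)
        then show ?thesis by (simp add: dist_norm)
      qed
      then have "C \<subseteq> cball p e" by (simp add: subset_iff)
      then show ?thesis using CC by blast
    qed
    have finite_Inter: "\<Inter>\<G> \<noteq> {}" if G: "finite \<G>" "\<G> \<subseteq> \<C>" for \<G>
    proof (cases "\<G> = {}")
      case False
      have "\<Inter>\<G> \<in> \<C>" using G(1) False G(2)
        by (induction rule: finite_ne_induct) (simp_all add: Int)
      then show ?thesis by (rule nonempty)
    qed simp
    show ?thesis
    proof (rule fip[THEN spec, THEN mp], intro conjI ballI allI impI)
      show "closed C" if "C \<in> \<C>" for C using that by (rule cl)
      show "\<exists>C a. C \<in> \<C> \<and> C \<subseteq> cball a e" if "0 < e" for e using that by (rule small)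
      show "\<Inter>\<G> \<noteq> {}" if "finite \<G> \<and> \<G> \<subseteq> \<C>" for \<G>
        using that by (elim conjE) (rule finite_Inter)
    qed
  qed
  then obtain p where p: "p \<in> \<Inter>\<C>" by blast
  have "p \<in> S" if "S \<in> \<S>" for S
  proof -
    have "{S} \<in> \<A>" "D < D + 1" using that by (simp_all add: \<A>_def)
    then have "\<Inter>{S} \<inter> cball 0 (D + 1) \<in> \<C>" unfolding \<C>_def by blast
    then have "p \<in> \<Inter>{S} \<inter> cball 0 (D + 1)" using p by (rule InterD[rotated])
    then show ?thesis by simp
  qed
  then show ?thesis by blast
qed

section \<open>Projection onto a closed convex set\<close>

lemma closest_point_exists_hilbert:
  fixes A :: "'a::{real_inner, banach} set"
  assumes "closed A" "convex A" "A \<noteq> {}"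
  obtains p where "p \<in> A" "\<forall>q\<in>A. dist u p \<le> dist u q"
proof -
  have bdd: "bdd_below (dist u ` A)" by simp
  define r0 where "r0 = (INF q\<in>A. dist u q)"
  define \<S> where "\<S> = (\<lambda>r. A \<inter> cball u r) ` {r0<..}"
  have ex: "A \<inter> cball u r \<noteq> {}" if "r0 < r" for r
    using that cINF_less_iff[OF assms(3) bdd, of r] by (force simp: r0_def)
  have "\<Inter>\<S> \<noteq> {}"
  proof (rule bounded_closed_convex_fip)
    show "A \<inter> cball u (r0 + 1) \<in> \<S>" by (simp add: \<S>_def)
    show "bounded (A \<inter> cball u (r0 + 1))" by (simp add: bounded_Int)
    fix S assume "S \<in> \<S>"
    then show "closed S" "convex S" using assms by (auto simp: \<S>_def intro: convex_Int)
  next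
    fix \<F> assume F: "finite \<F>" "\<F> \<subseteq> \<S>"
    then obtain I where I: "I \<subseteq> {r0<..}" "finite I" "\<F> = (\<lambda>r. A \<inter> cball u r) ` I"
      unfolding \<S>_def by (meson finite_subset_image)
    define s where "s = Min (insert (r0 + 1) I)"
    have "r0 < s" "\<And>r. r \<in> I \<Longrightarrow> s \<le> r"
      using I by (auto simp: s_def)
    then have "A \<inter> cball u s \<subseteq> \<Inter>\<F>" unfolding I(3) by fastforce
    then show "\<Inter>\<F> \<noteq> {}" using ex[OF \<open>r0 < s\<close>] by blast
  qed
  then obtain p where p: "p \<in> \<Inter>\<S>" by blast
  then have "p \<in> A" and r: "\<And>r. r0 < r \<Longrightarrow> dist u p \<le> r"
    by (auto simp: \<S>_def dest: bspec[of _ _ "r0 + 1"])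
  have "dist u p \<le> r0" using r by (rule dense_ge)
  moreover have "r0 \<le> dist u q" if "q \<in> A" for q
    unfolding r0_def using bdd that by (rule cINF_lower)
  ultimately show thesis using that \<open>p \<in> A\<close> by (meson order_trans)
qed

lemma proj_properties:
  fixes A :: "'a::{real_inner, banach} set"
  assumes "closed A" "convex A" "A \<noteq> {}"
  shows proj_in: "proj A u \<in> A"
    and proj_variational: "q \<in> A \<Longrightarrow> (u - proj A u) \<bullet> (q - proj A u) \<le> 0"
proof -
  obtain p where p: "p \<in> A" "\<forall>q\<in>A. dist u p \<le> dist u q"
    using closest_point_exists_hilbert[OF assms] by blast
  then have "proj A u = p" unfolding proj_def
    using any_closest_point_unique[OF assms(2,1)] by (intro the_equality) blast+
  then show "proj A u \<in> A" "q \<in> A \<Longrightarrow> (u - proj A u) \<bullet> (q - proj A u) \<le> 0"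
    using p any_closest_point_dot[OF assms(2,1)] by auto
qed

text \<open>The two hypotheses are the variational inequalities of the projections \<open>p\<close> and \<open>p'\<close> of \<open>u\<close>
  and \<open>u'\<close> onto a common convex set, each tested at the other projection.\<close>

lemma variational_projection_nonexpansive:
  fixes p p' :: "'a::real_inner"
  assumes "(u - p) \<bullet> (p' - p) \<le> 0" "(u' - p') \<bullet> (p - p') \<le> 0"
  shows "norm (p - p') \<le> norm (u - u')"
proof -
  have "(norm (p - p'))\<^sup>2 \<le> (u - u') \<bullet> (p - p')"
    using assms by (simp add: power2_norm_eq_inner inner_diff inner_commute algebra_simps)
  also have "\<dots> \<le> norm (u - u') * norm (p - p')" by (rule norm_cauchy_schwarz)
  finally show ?thesis
    by (metis mult_right_le_imp_le norm_ge_zero order_le_less power2_eq_square)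
qed

section \<open>Existence for strongly monotone variational inequalities\<close>

text \<open>A finite system of concave inequalities is solvable as soon as its matrix of values \<open>g x y\<close>
  has a nonnegative symmetric part. The solution is a minimiser \<open>p\<close> of the sum of the squared
  violations \<open>v x = max 0 (- g x p)\<close>: minimality in the direction of a vertex \<open>y\<close> bounds
  \<open>\<Sum>x. v x * g x y\<close> by \<open>- \<Sum>x. (v x)\<^sup>2\<close>, and averaging this over \<open>y\<close> with the weights \<open>v\<close>
  forces \<open>v = 0\<close>.\<close>

lemma concave_system_solvable:
  fixes X :: "'a::real_normed_vector set" and g :: "'a \<Rightarrow> 'a \<Rightarrow> real"
  assumes X: "finite X" "X \<noteq> {}"
    and concave: "\<And>x. x \<in> X \<Longrightarrow> concave_on (convex hull X) (g x)"
    and cont: "\<And>x. x \<in> X \<Longrightarrow> continuous_on (convex hull X) (g x)"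
    and pos: "\<And>x y. x \<in> X \<Longrightarrow> y \<in> X \<Longrightarrow> 0 \<le> g x y + g y x"
  obtains p where "p \<in> convex hull X" "\<And>x. x \<in> X \<Longrightarrow> 0 \<le> g x p"
proof -
  define F where "F = (\<lambda>p. \<Sum>x\<in>X. (max 0 (- g x p))\<^sup>2)"
  have "continuous_on (convex hull X) F"
    unfolding F_def by (intro continuous_intros cont)
  moreover have "convex hull X \<noteq> {}" using X by simp
  ultimately obtain p where p: "p \<in> convex hull X" "\<And>q. q \<in> convex hull X \<Longrightarrow> F p \<le> F q"
    using continuous_attains_inf[OF finite_imp_compact_convex_hull[OF X(1)]] by metis
  define v where "v = (\<lambda>x. max 0 (- g x p))"
  have v0: "0 \<le> v x" for x by (simp add: v_def)
  have vg: "v x * g x p = - (v x)\<^sup>2" for x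
    by (simp add: v_def max_def power2_eq_square)
  have descent: "(\<Sum>x\<in>X. v x * g x y) \<le> - (\<Sum>x\<in>X. (v x)\<^sup>2)" if y: "y \<in> X" for y
  proof -
    define e where "e = (\<lambda>x. g x y - g x p)"
    define B where "B = (\<Sum>x\<in>X. (e x)\<^sup>2)"
    define A where "A = (\<Sum>x\<in>X. v x * e x)"
    have yh: "y \<in> convex hull X" using y by (simp add: hull_inc)
    \<comment> \<open>\<open>-2 * A\<close> is the one-sided derivative of the bound on \<open>F\<close> along the segment from \<open>p\<close> to \<open>y\<close>.\<close>
    have tA: "2 * A \<le> t * B" if t: "0 < t" "t \<le> 1" for t
    proof -
      let ?q = "(1 - t) *\<^sub>R p + t *\<^sub>R y"
      have "?q \<in> convex hull X"
        using p(1) yh t by (intro convexD convex_convex_hull) auto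
      then have "F p \<le> F ?q" by (rule p(2))
      also have "\<dots> \<le> (\<Sum>x\<in>X. (v x - t * e x)\<^sup>2)"
        unfolding F_def
      proof (rule sum_mono)
        fix x assume x: "x \<in> X"
        have "(1 - t) * g x p + t * g x y \<le> g x ?q"
          using concave[OF x] p(1) yh t unfolding concave_on_iff by auto
        then have "- g x ?q \<le> v x - t * e x"
          by (simp add: v_def e_def algebra_simps max_def)
        then have "max 0 (- g x ?q) \<le> \<bar>v x - t * e x\<bar>" by simp
        then have "(max 0 (- g x ?q))\<^sup>2 \<le> \<bar>v x - t * e x\<bar>\<^sup>2" by (intro power_mono) auto
        then show "(max 0 (- g x ?q))\<^sup>2 \<le> (v x - t * e x)\<^sup>2" by simp
      qed
      also have "\<dots> = (\<Sum>x\<in>X. (v x)\<^sup>2 - 2 * t * (v x * e x) + t\<^sup>2 * (e x)\<^sup>2)"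
        by (intro sum.cong) (auto simp: power2_eq_square algebra_simps)
      also have "\<dots> = F p - 2 * t * A + t\<^sup>2 * B"
        by (simp add: sum.distrib sum_subtractf sum_distrib_left A_def B_def F_def v_def)
      finally have "t * (2 * A) \<le> t * (t * B)" by (simp add: power2_eq_square algebra_simps)
      with t show ?thesis by simp
    qed
    \<comment> \<open>Let \<open>t\<close> tend to \<open>0\<close>; the value below is small enough to contradict \<open>0 < A\<close>.\<close>
    have "A \<le> 0"
    proof (rule ccontr)
      assume "\<not> A \<le> 0"
      then have "0 < A" by simp
      have "0 \<le> B" by (simp add: B_def sum_nonneg)
      define t where "t = min 1 (A / (B + 1))"
      have "0 < t" "t \<le> 1" using \<open>0 < A\<close> \<open>0 \<le> B\<close> by (auto simp: t_def)
      moreover have "t * (B + 1) \<le> A"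
        using \<open>0 \<le> B\<close> min.cobounded2[of 1 "A / (B + 1)"] unfolding t_def[symmetric]
        by (subst (asm) pos_le_divide_eq) auto
      ultimately show False using tA[of t] \<open>0 < A\<close> by (simp add: algebra_simps)
    qed
    then show ?thesis
      by (simp add: A_def e_def right_diff_distrib sum_subtractf vg sum_negf sum.distrib)
  qed
  have "0 \<le> (\<Sum>y\<in>X. \<Sum>x\<in>X. v y * (v x * g x y))"
  proof -
    have "2 * (\<Sum>y\<in>X. \<Sum>x\<in>X. v y * (v x * g x y))
        = (\<Sum>y\<in>X. \<Sum>x\<in>X. v y * (v x * g x y)) + (\<Sum>y\<in>X. \<Sum>x\<in>X. v x * (v y * g y x))"
      by (subst (3) sum.swap) simp
    also have "\<dots> = (\<Sum>y\<in>X. \<Sum>x\<in>X. v y * v x * (g x y + g y x))"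
      by (simp add: sum.distrib[symmetric] algebra_simps)
    also have "\<dots> \<ge> 0" using pos v0 by (intro sum_nonneg mult_nonneg_nonneg) auto
    finally show ?thesis by simp
  qed
  also have "\<dots> = (\<Sum>y\<in>X. v y * (\<Sum>x\<in>X. v x * g x y))" by (simp add: sum_distrib_left)
  also have "\<dots> \<le> (\<Sum>y\<in>X. v y * - (\<Sum>x\<in>X. (v x)\<^sup>2))"
    using descent v0 by (intro sum_mono mult_left_mono) auto
  also have "\<dots> = - ((\<Sum>y\<in>X. v y) * (\<Sum>x\<in>X. (v x)\<^sup>2))"
    by (simp add: sum_distrib_right sum_negf)
  finally have "(\<Sum>y\<in>X. v y) * (\<Sum>x\<in>X. (v x)\<^sup>2) \<le> 0" by simp
  moreover have "0 \<le> (\<Sum>y\<in>X. v y)" "0 \<le> (\<Sum>x\<in>X. (v x)\<^sup>2)" using v0 by (auto intro: sum_nonneg)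
  ultimately have "(\<Sum>y\<in>X. v y) = 0 \<or> (\<Sum>x\<in>X. (v x)\<^sup>2) = 0" by (auto simp: mult_le_0_iff)
  then have "v x = 0" if "x \<in> X" for x
    using that X(1) v0 by (auto simp: sum_nonneg_eq_0_iff)
  then have "0 \<le> g x p" if "x \<in> X" for x
    using that by (metis v_def max.cobounded2 neg_le_0_iff_le)
  then show thesis using that p(1) by blast
qed

lemma convex_on_norm_square:
  fixes c :: "'a::real_inner"
  shows "convex_on UNIV (\<lambda>x. (norm (c - x))\<^sup>2)"
proof -
  have "(norm (c - (u *\<^sub>R x + v *\<^sub>R y)))\<^sup>2 \<le> u * (norm (c - x))\<^sup>2 + v * (norm (c - y))\<^sup>2"
    if uv: "0 \<le> u" "0 \<le> v" "u + v = 1" for u v x y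
  proof -
    have v: "v = 1 - u" using uv by simp
    have "u * (norm (c - x))\<^sup>2 + v * (norm (c - y))\<^sup>2 - (norm (c - (u *\<^sub>R x + v *\<^sub>R y)))\<^sup>2
        = u * v * (norm (x - y))\<^sup>2"
      unfolding v power2_norm_eq_inner
      by (simp add: inner_diff inner_add inner_commute algebra_simps)
    moreover have "\<dots> \<ge> 0" using uv by simp
    ultimately show ?thesis by linarith
  qed
  then show ?thesis by (simp add: convex_on_def)
qed

text \<open>Minty's method. The sets \<open>S x\<close> below are the solution sets of the inequalities of the dual
  (Minty) problem, strengthened by the quadratic term \<open>\<alpha> / 2 * (norm (x - y))\<^sup>2\<close>. That term
  makes each \<open>S x\<close> bounded, and \<open>\<alpha> / 2\<close> is the largest factor for which strong monotonicity still
  gives \<open>0 \<le> g x y + g y x\<close>.\<close>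

lemma strongly_monotone_vi_solvable:
  fixes K :: "'a::{real_inner, banach} set"
  assumes K: "closed K" "convex K" "K \<noteq> {}"
    and f: "strongly_monotone \<alpha> f" "0 < \<alpha>" "hemicontinuous f"
    and \<phi>: "convex_on K \<phi>" "L-lipschitz_on K \<phi>"
  obtains z where "z \<in> K" "\<And>x. x \<in> K \<Longrightarrow> 0 \<le> f z \<bullet> (x - z) + (\<phi> x - \<phi> z)"
proof -
  define g where "g = (\<lambda>x y. f x \<bullet> (x - y) + (\<phi> x - \<phi> y) - \<alpha> / 2 * (norm (x - y))\<^sup>2)"
  define S where "S = (\<lambda>x. {y \<in> K. 0 \<le> g x y})"
  have concave: "concave_on K (g x)" for x
  proof -
    have "u * g x y + v * g x w \<le> g x (u *\<^sub>R y + v *\<^sub>R w)"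
      if "y \<in> K" "w \<in> K" "0 \<le> u" "0 \<le> v" "u + v = 1" for y w u v
    proof -
      have "\<phi> (u *\<^sub>R y + v *\<^sub>R w) \<le> u * \<phi> y + v * \<phi> w"
        using \<phi>(1) that unfolding convex_on_def by blast
      moreover have "\<alpha> / 2 * (norm (x - (u *\<^sub>R y + v *\<^sub>R w)))\<^sup>2
          \<le> u * (\<alpha> / 2 * (norm (x - y))\<^sup>2) + v * (\<alpha> / 2 * (norm (x - w))\<^sup>2)"
      proof -
        have "(norm (x - (u *\<^sub>R y + v *\<^sub>R w)))\<^sup>2 \<le> u * (norm (x - y))\<^sup>2 + v * (norm (x - w))\<^sup>2"
          using convex_on_norm_square[of x] that unfolding convex_on_def by blast
        then have "\<alpha> / 2 * (norm (x - (u *\<^sub>R y + v *\<^sub>R w)))\<^sup>2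
            \<le> \<alpha> / 2 * (u * (norm (x - y))\<^sup>2 + v * (norm (x - w))\<^sup>2)"
          using f(2) by (intro mult_left_mono) auto
        then show ?thesis by (simp add: distrib_left mult_ac)
      qed
      moreover have v: "v = 1 - u" using that by simp
      have "f x \<bullet> (x - (u *\<^sub>R y + v *\<^sub>R w)) = u * (f x \<bullet> (x - y)) + v * (f x \<bullet> (x - w))"
        unfolding v by (simp add: inner_diff_right inner_add_right algebra_simps)
      moreover have "u * \<phi> x + v * \<phi> x = \<phi> x" unfolding v by (simp add: left_diff_distrib)
      ultimately show ?thesis
        unfolding g_def distrib_left right_diff_distrib by linarith
    qed
    then show ?thesis using K(2) by (simp add: concave_on_iff)
  qed
  have cont: "continuous_on K (g x)" for x
    unfolding g_def using lipschitz_on_continuous_on[OF \<phi>(2)] by (intro continuous_intros)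
  have sym: "0 \<le> g x y + g y x" for x y
  proof -
    have "g x y + g y x = (f x - f y) \<bullet> (x - y) - \<alpha> * ((x - y) \<bullet> (x - y))"
      unfolding dot_square_norm
      by (simp add: g_def norm_minus_commute[of y x] inner_diff_left inner_diff_right)
    then show ?thesis using f(1) by (simp add: strongly_monotone_def)
  qed
  obtain x0 where x0: "x0 \<in> K" using K(3) by blast
  have "\<Inter>(S ` K) \<noteq> {}"
  proof (rule bounded_closed_convex_fip)
    show "S x0 \<in> S ` K" using x0 by blast
    have "dist x0 y \<le> 2 * (norm (f x0) + L) / \<alpha>" if y: "y \<in> S x0" for y
    proof (cases "x0 = y")
      case True
      then show ?thesis using f(2) lipschitz_on_nonneg[OF \<phi>(2)] by simp
    next
      case False
      define r where "r = norm (x0 - y)"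
      have r: "0 < r" using False by (simp add: r_def)
      have "f x0 \<bullet> (x0 - y) \<le> norm (f x0) * r"
        unfolding r_def by (rule norm_cauchy_schwarz)
      moreover have "\<phi> x0 - \<phi> y \<le> L * r"
        using lipschitz_onD[OF \<phi>(2) x0, of y] y by (simp add: S_def dist_norm r_def)
      moreover have "0 \<le> f x0 \<bullet> (x0 - y) + (\<phi> x0 - \<phi> y) - \<alpha> / 2 * r\<^sup>2"
        using y by (simp add: S_def g_def r_def)
      ultimately have "r * (\<alpha> * r) \<le> r * (2 * (norm (f x0) + L))"
        by (simp add: power2_eq_square algebra_simps)
      then have "\<alpha> * r \<le> 2 * (norm (f x0) + L)" using r by simp
      then show ?thesis using f(2) by (simp add: dist_norm r_def[symmetric] field_simps)
    qed
    then show "bounded (S x0)" by (metis bounded_def)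
  next
    fix T assume "T \<in> S ` K"
    then obtain x where T: "T = S x" by blast
    have "S x = {y \<in> K. 0 \<le> g x y}" by (simp add: S_def)
    also have "\<dots> = K \<inter> g x -` {0..}" by auto
    finally show "closed T"
      unfolding T using continuous_on_closed_vimage[OF K(1)] cont by (metis closed_atLeast Int_commute)
    show "convex T" unfolding T
    proof (rule convexI)
      fix y w and u v :: real
      assume *: "y \<in> S x" "w \<in> S x" "0 \<le> u" "0 \<le> v" "u + v = 1"
      then have "0 \<le> u * g x y + v * g x w" by (simp add: S_def)
      also have "\<dots> \<le> g x (u *\<^sub>R y + v *\<^sub>R w)"
        using concave * unfolding concave_on_iff S_def by blast
      finally show "u *\<^sub>R y + v *\<^sub>R w \<in> S x"
        using * K(2) by (simp add: S_def convexD)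
    qed
  next
    fix \<F> assume "finite \<F>" "\<F> \<subseteq> S ` K"
    then obtain X where X: "X \<subseteq> K" "finite X" "\<F> = S ` X"
      by (meson finite_subset_image)
    show "\<Inter>\<F> \<noteq> {}"
    proof (cases "X = {}")
      case False
      have hull: "convex hull X \<subseteq> K" using X(1) K(2) by (rule hull_minimal)
      have "concave_on (convex hull X) (g x)" for x
        using concave[of x] hull unfolding concave_on_def by (rule convex_on_subset) simp
      moreover have "continuous_on (convex hull X) (g x)" for x
        using cont hull by (rule continuous_on_subset)
      ultimately obtain p where p: "p \<in> convex hull X" "\<And>x. x \<in> X \<Longrightarrow> 0 \<le> g x p"
        using concave_system_solvable[OF X(2) False] sym by metis
      then have "p \<in> \<Inter>\<F>" using hull by (auto simp: X(3) S_def)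
      then show ?thesis by blast
    qed (simp add: X(3))
  qed
  then obtain z where z: "\<And>x. x \<in> K \<Longrightarrow> z \<in> S x" by blast
  then have zK: "z \<in> K" using x0 by (auto simp: S_def)
  \<comment> \<open>Minty's argument: test at the points of the segment from \<open>z\<close> to \<open>x\<close>, divide by \<open>t\<close> and let
    \<open>t\<close> tend to \<open>0\<close>.\<close>
  have "0 \<le> f z \<bullet> (x - z) + (\<phi> x - \<phi> z)" if x: "x \<in> K" for x
  proof -
    define h where "h = (\<lambda>t. f (z + t *\<^sub>R (x - z)) \<bullet> (x - z) + (\<phi> x - \<phi> z))"
    have "0 \<le> h t" if t: "0 < t" "t < 1" for t
    proof -
      let ?w = "z + t *\<^sub>R (x - z)"
      have w: "?w = (1 - t) *\<^sub>R z + t *\<^sub>R x" by (simp add: algebra_simps)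
      have "?w \<in> K" unfolding w using K(2) zK x t by (intro convexD) auto
      then have "0 \<le> g ?w z" using z by (simp add: S_def)
      also have "\<dots> \<le> f ?w \<bullet> (?w - z) + (\<phi> ?w - \<phi> z)"
        using f(2) by (simp add: g_def)
      also have "\<phi> ?w \<le> (1 - t) * \<phi> z + t * \<phi> x"
        unfolding w using \<phi>(1) zK x t unfolding convex_on_def by auto
      finally have "0 \<le> t * h t" by (simp add: h_def algebra_simps)
      then show ?thesis using t by (simp add: zero_le_mult_iff)
    qed
    then have "eventually (\<lambda>t. 0 \<le> h t) (at_right 0)"
      using eventually_at_right_real[of 0 "1::real"] by (auto elim: eventually_mono)
    moreover have "(h \<longlongrightarrow> h 0) (at_right 0)"
    proof -
      have "continuous_on {0..1::real} h"
        unfolding h_def using f(3) unfolding hemicontinuous_def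
        by (intro continuous_on_add continuous_on_const) blast
      then show ?thesis
        by (metis at_within_Icc_at_right atLeastAtMost_iff continuous_on order_refl zero_le_one
            zero_less_one)
    qed
    ultimately have "0 \<le> h 0" by (intro tendsto_lowerbound) auto
    then show ?thesis by (simp add: h_def)
  qed
  then show thesis using that zK by blast
qed

section \<open>The primal problem\<close>

lemma primal_vi_cross_estimate:
  assumes "strongly_monotone \<alpha> f" "primal_vi K f a b y x" "primal_vi K f a b y' x'"
  shows "(a x - a x') \<bullet> (b y - b y') \<le> - \<alpha> * (norm (x - x'))\<^sup>2"
proof -
  have "0 \<le> f x \<bullet> (x' - x) + (a x' - a x) \<bullet> b y"
    and "0 \<le> f x' \<bullet> (x - x') + (a x - a x') \<bullet> b y'"
    using assms(2,3) by (auto simp: primal_vi_def)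
  moreover have "\<alpha> * ((x - x') \<bullet> (x - x')) \<le> (f x - f x') \<bullet> (x - x')"
    using assms(1) by (simp add: strongly_monotone_def)
  ultimately show ?thesis
    by (simp add: power2_norm_eq_inner inner_diff_left inner_diff_right)
qed

lemma primal_vi_unique:
  assumes "strongly_monotone \<alpha> f" "0 < \<alpha>" "primal_vi K f a b y x" "primal_vi K f a b y x'"
  shows "x = x'"
  using primal_vi_cross_estimate[OF assms(1,3,4)] assms(2) by (simp add: mult_le_0_iff)

lemma primal_vi_exists:
  fixes K :: "'h::{real_inner, banach} set"
  assumes "closed K" "convex K" "K \<noteq> {}"
    and "strongly_monotone \<alpha> f" "0 < \<alpha>" "hemicontinuous f"
    and "convex_on UNIV (\<lambda>x. a x \<bullet> b y)" "C-lipschitz_on UNIV a"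
  obtains z where "primal_vi K f a b y z"
proof -
  have "(C * norm (b y))-lipschitz_on K (\<lambda>x. a x \<bullet> b y)"
  proof (rule lipschitz_onI)
    show "0 \<le> C * norm (b y)" using lipschitz_on_nonneg[OF assms(8)] by simp
    fix u v
    have "dist (a u \<bullet> b y) (a v \<bullet> b y) \<le> norm (a u - a v) * norm (b y)"
      by (simp add: dist_real_def inner_diff_left[symmetric] Cauchy_Schwarz_ineq2)
    also have "\<dots> \<le> (C * dist u v) * norm (b y)"
      using lipschitz_onD[OF assms(8), of u v] by (intro mult_right_mono) (simp_all add: dist_norm)
    finally show "dist (a u \<bullet> b y) (a v \<bullet> b y) \<le> C * norm (b y) * dist u v"
      by (simp add: mult_ac)
  qed
  moreover have "convex_on K (\<lambda>x. a x \<bullet> b y)"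
    using assms(7,2) by (auto intro: convex_on_subset)
  ultimately obtain z where "z \<in> K"
      "\<And>x. x \<in> K \<Longrightarrow> 0 \<le> f z \<bullet> (x - z) + (a x \<bullet> b y - a z \<bullet> b y)"
    using strongly_monotone_vi_solvable[OF assms(1-6)] by metis
  then have "primal_vi K f a b y z" by (simp add: primal_vi_def inner_diff_left)
  then show thesis by (rule that)
qed

section \<open>The dual iteration\<close>

text \<open>Both \<open>b y'\<close> and \<open>b ys\<close> are projections onto \<open>b ` K2\<close>: the first one by the update rule, the
  second one because \<open>dual_vi\<close> says that \<open>b ys\<close> is the projection of \<open>b ys + \<delta> *\<^sub>R a xs\<close>.\<close>

lemma dual_step_estimate:
  fixes b :: "'h2::real_inner \<Rightarrow> 'h3::{real_inner, banach}"
  assumes bK: "closed (b ` K2)" "convex (b ` K2)"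
    and f: "strongly_monotone \<alpha> f" and a: "C-lipschitz_on UNIV a" and \<delta>: "0 < \<delta>"
    and sol: "primal_vi K1 f a b ys xs" "dual_vi K2 a b xs ys"
    and step: "primal_vi K1 f a b y x" "y' \<in> dual_updates K2 a b \<delta> x y"
  shows "\<delta> * (2 * \<alpha> - \<delta> * C\<^sup>2) * (norm (x - xs))\<^sup>2
    \<le> (norm (b y - b ys))\<^sup>2 - (norm (b y' - b ys))\<^sup>2"
proof -
  define q where "q = b y - b ys"
  define d where "d = a x - a xs"
  have ys: "ys \<in> K2" using sol(2) by (simp add: dual_vi_def)
  then have ne: "b ` K2 \<noteq> {}" by blast
  have y': "b y' = proj (b ` K2) (b y + \<delta> *\<^sub>R a x)" using step(2) by (simp add: dual_updates_def)
  have "b y' \<in> b ` K2" unfolding y' by (rule proj_in[OF bK ne])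
  then have "((b ys + \<delta> *\<^sub>R a xs) - b ys) \<bullet> (b y' - b ys) \<le> 0"
    using sol(2) \<delta> by (auto simp: dual_vi_def mult_le_0_iff)
  moreover have "((b y + \<delta> *\<^sub>R a x) - b y') \<bullet> (b ys - b y') \<le> 0"
    unfolding y' using ys by (intro proj_variational[OF bK ne]) blast
  ultimately have "norm (b y' - b ys) \<le> norm ((b y + \<delta> *\<^sub>R a x) - (b ys + \<delta> *\<^sub>R a xs))"
    by (intro variational_projection_nonexpansive)
  also have "\<dots> = norm (q + \<delta> *\<^sub>R d)" by (simp add: q_def d_def algebra_simps)
  finally have "(norm (b y' - b ys))\<^sup>2 \<le> (norm (q + \<delta> *\<^sub>R d))\<^sup>2" by (intro power_mono) auto
  also have "\<dots> = (norm q)\<^sup>2 + 2 * \<delta> * (d \<bullet> q) + \<delta>\<^sup>2 * (norm d)\<^sup>2"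
    unfolding power2_norm_eq_inner
    by (simp add: inner_add_left inner_add_right inner_commute power2_eq_square)
  also have "\<dots> \<le> (norm q)\<^sup>2 + 2 * \<delta> * (- \<alpha> * (norm (x - xs))\<^sup>2) + \<delta>\<^sup>2 * (C * norm (x - xs))\<^sup>2"
  proof -
    have "d \<bullet> q \<le> - \<alpha> * (norm (x - xs))\<^sup>2"
      unfolding d_def q_def using f step(1) sol(1) by (rule primal_vi_cross_estimate)
    moreover have "norm d \<le> C * norm (x - xs)"
      using lipschitz_onD[OF a, of x xs] by (simp add: d_def dist_norm)
    ultimately show ?thesis
      using \<delta> by (intro add_mono mult_left_mono power_mono) auto
  qed
  finally show ?thesis
    by (simp add: q_def power2_eq_square algebra_simps)
qed

section \<open>Well-posedness and convergence of the algorithm\<close>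

lemma tendsto_of_descent:
  fixes x :: "nat \<Rightarrow> 'a::real_normed_vector" and e :: "nat \<Rightarrow> real"
  assumes "0 < c" "\<And>n. 0 \<le> e n" "\<And>n. c * (norm (x n - l))\<^sup>2 \<le> e n - e (Suc n)"
  shows "x \<longlonglongrightarrow> l"
proof -
  have "summable (\<lambda>n. c * (norm (x n - l))\<^sup>2)"
  proof (rule bounded_imp_summable)
    show "0 \<le> c * (norm (x n - l))\<^sup>2" for n using assms(1) by simp
    have "(\<Sum>k\<le>n. c * (norm (x k - l))\<^sup>2) \<le> e 0 - e (Suc n)" for n
    proof (induction n)
      case (Suc n)
      then show ?case using assms(3)[of "Suc n"] by simp
    qed (use assms(3)[of 0] in simp)
    then show "(\<Sum>k\<le>n. c * (norm (x k - l))\<^sup>2) \<le> e 0" for n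
      using assms(2)[of "Suc n"] by (meson diff_le_eq le_add_same_cancel1 order_trans)
  qed
  then have "summable (\<lambda>n. (norm (x n - l))\<^sup>2)" using assms(1) by simp
  then have "(\<lambda>n. sqrt ((norm (x n - l))\<^sup>2)) \<longlonglongrightarrow> sqrt 0"
    by (intro tendsto_real_sqrt summable_LIMSEQ_zero)
  then show ?thesis by (simp add: tendsto_norm_zero_iff LIM_zero_iff)
qed

theorem theorem2:
  fixes K1 :: "'h1::{real_inner, banach} set"
    and K2 :: "'h2::{real_inner, banach} set"
    and a :: "'h1 \<Rightarrow> 'h3::{real_inner, banach}"
    and b :: "'h2 \<Rightarrow> 'h3"
    and f :: "'h1 \<Rightarrow> 'h1"
    and \<alpha> C \<delta> :: real
    and xs :: 'h1 and ys y0 :: 'h2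
  assumes "closed K1" and "convex K1"
    and "closed K2" and "convex K2"
    and "\<And>y. y \<in> K2 \<Longrightarrow> convex_on UNIV (\<lambda>x. a x \<bullet> b y)"
    and "closed (b ` K2)" and "convex (b ` K2)"
    and "strongly_monotone \<alpha> f"
    and "C > 0" and "C-lipschitz_on UNIV a" and "\<And>x. a differentiable (at x)"
    and "primal_vi K1 f a b ys xs" and "dual_vi K2 a b xs ys"
    and "y0 \<in> K2"
    and "0 < \<delta>" and "\<delta> < 2 * \<alpha> / C\<^sup>2"
  shows
    "(\<forall>N x y. iterates_upto K1 K2 f a b \<delta> y0 N x y \<longrightarrow>
        (\<exists>\<^sub>\<le>\<^sub>1z. primal_vi K1 f a b (y N) z) \<and>
        (hemicontinuous f \<longrightarrow> (\<exists>z. primal_vi K1 f a b (y N) z)) \<and>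
        (\<forall>z. primal_vi K1 f a b (y N) z \<longrightarrow> dual_updates K2 a b \<delta> z (y N) \<inter> K2 \<noteq> {}))
     \<and> (hemicontinuous f \<longrightarrow>
        (\<exists>x y. iterates K1 K2 f a b \<delta> y0 x y \<and> range y \<subseteq> K2))
     \<and> (\<forall>x y. iterates K1 K2 f a b \<delta> y0 x y \<longrightarrow> x \<longlonglongrightarrow> xs)"
proof -
  have \<delta>C: "\<delta> * C\<^sup>2 < 2 * \<alpha>" using assms(9,16) by (simp add: pos_less_divide_eq)
  moreover have "0 < \<delta> * C\<^sup>2" using assms(9,15) by simp
  ultimately have \<alpha>: "0 < \<alpha>" by linarith
  have K1: "K1 \<noteq> {}" using assms(12) by (auto simp: primal_vi_def)
  have bK2: "b ` K2 \<noteq> {}" using assms(14) by blast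
  \<comment> \<open>An iterate \<open>y n\<close> may lie outside \<open>K2\<close>, but the primal problem depends on it only through
    \<open>b (y n)\<close>, which lies in \<open>b ` K2\<close>.\<close>
  have primal: "\<exists>z. primal_vi K1 f a b y z" if "hemicontinuous f" "b y \<in> b ` K2" for y
  proof -
    obtain w where "w \<in> K2" "b y = b w" using \<open>b y \<in> b ` K2\<close> by blast
    then have "convex_on UNIV (\<lambda>x. a x \<bullet> b y)" using assms(5) by simp
    then show ?thesis
      using primal_vi_exists[where b = b and y = y] assms(1,2,8,10) K1 \<alpha> \<open>hemicontinuous f\<close>
      by metis
  qed
  have dual: "\<exists>w. w \<in> dual_updates K2 a b \<delta> x y \<inter> K2" for x y
    using proj_in[OF assms(6,7) bK2, of "b y + \<delta> *\<^sub>R a x"]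
    by (force simp: dual_updates_def)
  show ?thesis
  proof (intro conjI allI impI)
    fix N x y assume it: "iterates_upto K1 K2 f a b \<delta> y0 N x y"
    show "\<exists>\<^sub>\<le>\<^sub>1z. primal_vi K1 f a b (y N) z"
      by (rule Uniq_I) (rule primal_vi_unique[OF assms(8) \<alpha>])
    have "b (y N) \<in> b ` K2"
    proof (cases N)
      case 0
      then show ?thesis using it assms(14) by (simp add: iterates_upto_def)
    next
      case (Suc n)
      then have "y N \<in> dual_updates K2 a b \<delta> (x n) (y n)"
        using it by (simp add: iterates_upto_def)
      then show ?thesis using proj_in[OF assms(6,7) bK2] by (simp add: dual_updates_def)
    qed
    then show "\<exists>z. primal_vi K1 f a b (y N) z" if "hemicontinuous f"
      using that primal by blast
    show "dual_updates K2 a b \<delta> z (y N) \<inter> K2 \<noteq> {}" for z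
      using dual by blast
  next
    assume hemi: "hemicontinuous f"
    have "\<exists>p. \<forall>n. (snd (p n) \<in> K2 \<and> primal_vi K1 f a b (snd (p n)) (fst (p n)) \<and> (n = 0 \<longrightarrow> snd (p n) = y0))
        \<and> snd (p (Suc n)) \<in> dual_updates K2 a b \<delta> (fst (p n)) (snd (p n))"
    proof (rule dependent_nat_choice)
      obtain z where "primal_vi K1 f a b y0 z" using primal[OF hemi] assms(14) by blast
      then show "\<exists>p. snd p \<in> K2 \<and> primal_vi K1 f a b (snd p) (fst p) \<and> (0 = (0::nat) \<longrightarrow> snd p = y0)"
        using assms(14) by (intro exI[of _ "(z, y0)"]) simp
    next
      fix p n
      obtain w where w: "w \<in> dual_updates K2 a b \<delta> (fst p) (snd p)" "w \<in> K2" using dual by blast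
      then obtain z where "primal_vi K1 f a b w z" using primal[OF hemi] by blast
      then show "\<exists>q. (snd q \<in> K2 \<and> primal_vi K1 f a b (snd q) (fst q) \<and> (Suc n = 0 \<longrightarrow> snd q = y0))
          \<and> snd q \<in> dual_updates K2 a b \<delta> (fst p) (snd p)"
        using w by (intro exI[of _ "(z, w)"]) simp
    qed
    then obtain p where p: "\<And>n. snd (p n) \<in> K2" "\<And>n. primal_vi K1 f a b (snd (p n)) (fst (p n))"
        "snd (p 0) = y0" "\<And>n. snd (p (Suc n)) \<in> dual_updates K2 a b \<delta> (fst (p n)) (snd (p n))"
      by blast
    show "\<exists>x y. iterates K1 K2 f a b \<delta> y0 x y \<and> range y \<subseteq> K2"
      using p by (intro exI[of _ "\<lambda>n. fst (p n)"] exI[of _ "\<lambda>n. snd (p n)"])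
        (auto simp: iterates_def)
  next
    fix x y assume it: "iterates K1 K2 f a b \<delta> y0 x y"
    show "x \<longlonglongrightarrow> xs"
    proof (rule tendsto_of_descent)
      show "0 < \<delta> * (2 * \<alpha> - \<delta> * C\<^sup>2)" using \<delta>C assms(15) by simp
      show "\<delta> * (2 * \<alpha> - \<delta> * C\<^sup>2) * (norm (x n - xs))\<^sup>2
          \<le> (norm (b (y n) - b ys))\<^sup>2 - (norm (b (y (Suc n)) - b ys))\<^sup>2" for n
        using it by (intro dual_step_estimate[OF assms(6,7,8,10,15,12,13)]) (auto simp: iterates_def)
    qed simp
  qed
qed

end
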